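(* Let $n\ge 1$ and let $e_1,\dots,e_n$ be the standard basis of $\mathbb{C}^n$, and let $i=\sqrt{-1}$. The complex frame $\mathcal{F}_{\mathbb{C}}=\{e_1,\ldots,e_n\}\cup\{e_k+e_l\}_{1\le k<l\le n}\cup\{e_k+i\,e_l\}_{1\le k<l\le n}$ in $\mathbb{C}^n$ is vital.
   Context: A frame in $\mathbb{C}^n$ is a finite set of vectors spanning $\mathbb{C}^n$. A finite set $\{v_r\}_{r=1}^m\subset\mathbb{C}^n$ permits phase retrieval if for all $\psi,\phi\in\mathbb{C}^n$, the equalities $|\langle v_r,\psi\rangle|^2=|\langle v_r,\phi\rangle|^2$ for all $r$ imply $\phi=c\,\psi$ for some $c\in\mathbb{C}$ with $|c|=1$. A frame is vital if it permits phase retrieval, but removing any single vector from it yields a set that does not permit phase retrieval. *)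

theory Defs
  imports "HOL-Analysis.Analysis"
begin

text \<open>The standard Hermitian inner product on \<open>complex ^ 'n\<close>; the library's \<open>\<bullet>\<close> on this type is
  only its real part. Only \<open>|\<langle>v, \<psi>\<rangle>|\<close> is used below, so which argument is conjugated is immaterial.\<close>

definition hermitian_inner :: "complex ^ 'n \<Rightarrow> complex ^ 'n \<Rightarrow> complex" where
  "hermitian_inner v w = (\<Sum>j\<in>UNIV. v $ j * cnj (w $ j))"

text \<open>\<open>vec.span\<close> is the linear span over the scalar field \<open>complex\<close>, whereas \<open>span\<close> would be
  the real span.\<close>

definition is_frame :: "(complex ^ 'n) set \<Rightarrow> bool" where
  "is_frame S \<longleftrightarrow> finite S \<and> vec.span S = UNIV"

definition permits_phase_retrieval :: "(complex ^ 'n) set \<Rightarrow> bool" where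
  "permits_phase_retrieval S \<longleftrightarrow>
    (\<forall>\<psi> \<phi>. (\<forall>v\<in>S. (cmod (hermitian_inner v \<psi>))\<^sup>2 = (cmod (hermitian_inner v \<phi>))\<^sup>2)
      \<longrightarrow> (\<exists>c. cmod c = 1 \<and> \<phi> = c *s \<psi>))"

definition vital :: "(complex ^ 'n) set \<Rightarrow> bool" where
  "vital S \<longleftrightarrow> is_frame S \<and> permits_phase_retrieval S \<and>
    (\<forall>v\<in>S. \<not> permits_phase_retrieval (S - {v}))"

text \<open>The index type is an arbitrary nonempty finite linear order, standing for \<open>1 < \<dots> < n\<close> with
  \<open>n = CARD('n) \<ge> 1\<close>; the order is needed only for the condition \<open>k < l\<close>. The standard basis
  vector with index \<open>k\<close> is \<open>axis k 1\<close>.\<close>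

definition complex_frame :: "(complex ^ 'n::{finite,linorder}) set" where
  "complex_frame =
    {axis k 1 | k. True} \<union>
    {axis k 1 + axis l 1 | k l. k < l} \<union>
    {axis k 1 + \<i> *s axis l 1 | k l. k < l}"

end

theory Submission
  imports Defs
begin

text \<open>The three kinds of measurements determine, by polarisation, all products
  \<open>\<psi>\<^sub>k * cnj \<psi>\<^sub>l\<close>, that is the rank-one matrix \<open>\<psi> \<psi>\<^sup>*\<close>, and hence \<open>\<psi>\<close> up to a phase.
  Dropping \<open>e\<^sub>k + e\<^sub>l\<close> loses the real part of one such product, so \<open>e\<^sub>k \<plusminus> e\<^sub>l\<close> become
  indistinguishable; dropping \<open>e\<^sub>k + \<i> e\<^sub>l\<close> loses its imaginary part, which confuses
  \<open>e\<^sub>k \<plusminus> \<i> e\<^sub>l\<close>. When \<open>e\<^sub>k\<close> is dropped, the remaining data on the coordinate \<open>t = \<psi>\<^sub>k\<close> are its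
  distances to \<open>-\<psi>\<^sub>j\<close> and to \<open>-\<i> \<psi>\<^sub>j\<close> (for \<open>j < k\<close>) or \<open>\<i> \<psi>\<^sub>j\<close> (for \<open>k < j\<close>). With \<open>\<psi>\<^sub>j = 1\<close> for
  \<open>j < k\<close> and \<open>\<psi>\<^sub>j = \<i>\<close> for \<open>k < j\<close> these centres are just \<open>-1\<close> and \<open>-\<i>\<close>, and reflection in the
  line through them exchanges \<open>t = 0\<close> and \<open>t = -1 - \<i>\<close>.\<close>

lemma axis_component: "axis k x $ j = (if j = k then x else 0)"
  by (simp add: axis_def)

lemma hermitian_inner_axis [simp]: "hermitian_inner (axis k 1) w = cnj (w $ k)"
  by (simp add: hermitian_inner_def axis_def if_distrib[of "\<lambda>x. x * _"] cong: if_cong)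

lemma hermitian_inner_add_left [simp]:
  "hermitian_inner (u + v) w = hermitian_inner u w + hermitian_inner v w"
  by (simp add: hermitian_inner_def distrib_right sum.distrib)

lemma hermitian_inner_scale_left [simp]:
  "hermitian_inner (c *s v) w = c * hermitian_inner v w"
  by (simp add: hermitian_inner_def sum_distrib_left mult.assoc)

text \<open>Expanding the squares, the third equation isolates the real part of
  \<open>a * cnj b\<close>, the fourth its imaginary part.\<close>

lemma polarisation:
  fixes a b a' b' :: complex
  assumes "(cmod a)\<^sup>2 = (cmod a')\<^sup>2" "(cmod b)\<^sup>2 = (cmod b')\<^sup>2"
    and "(cmod (a + b))\<^sup>2 = (cmod (a' + b'))\<^sup>2"
    and "(cmod (a + \<i> * b))\<^sup>2 = (cmod (a' + \<i> * b'))\<^sup>2"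
  shows "a * cnj b = a' * cnj b'"
  using assms unfolding complex_eq_iff cmod_power2
  by (simp add: power2_eq_square algebra_simps)

lemma eq_phase_multiple_if_products_eq:
  fixes \<psi> \<phi> :: "complex ^ 'n"
  assumes "\<And>k l. \<psi> $ k * cnj (\<psi> $ l) = \<phi> $ k * cnj (\<phi> $ l)"
  shows "\<exists>c. cmod c = 1 \<and> \<phi> = c *s \<psi>"
proof -
  have norm_eq: "cmod (\<psi> $ k) = cmod (\<phi> $ k)" for k
    using assms[of k k] by (simp flip: complex_norm_square of_real_power)
  show ?thesis
  proof (cases "\<psi> = 0")
    case True
    then have "\<phi> = 0"
      using norm_eq by (simp add: vec_eq_iff)
    with True show ?thesis
      by (intro exI[of _ 1]) simp
  next
    case False
    then obtain k where k: "\<psi> $ k \<noteq> 0"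
      by (auto simp: vec_eq_iff)
    then have k': "\<phi> $ k \<noteq> 0"
      using norm_eq[of k] by auto
    \<comment> \<open>One nonzero coordinate fixes the phase; the products with it then determine
      all other coordinates.\<close>
    define c where "c = \<phi> $ k / \<psi> $ k"
    have "\<phi> $ l = c * \<psi> $ l" for l
    proof -
      have "cnj (\<phi> $ k) * (\<phi> $ l * \<psi> $ k) = cnj (\<phi> $ k) * (\<phi> $ k * \<psi> $ l)"
        using assms[of l k] assms[of k k] by algebra
      with k k' show ?thesis
        by (simp add: c_def field_simps)
    qed
    moreover have "cmod c = 1"
      using norm_eq[of k] k k' by (simp add: c_def norm_divide)
    ultimately show ?thesis
      by (auto simp: vec_eq_iff)
  qed
qed

lemma is_frame_complex_frame:
  "is_frame (complex_frame :: (complex ^ 'n::{finite,linorder}) set)"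
proof -
  let ?S = "complex_frame :: (complex, 'n) vec set"
  have "?S \<subseteq> range (\<lambda>k. axis k 1) \<union> range (\<lambda>(k, l). axis k 1 + axis l 1)
      \<union> range (\<lambda>(k, l). axis k 1 + \<i> *s axis l 1)"
    by (force simp: complex_frame_def)
  then have "finite ?S"
    by (rule finite_subset) simp
  moreover have "cart_basis \<subseteq> ?S"
    by (auto simp: complex_frame_def cart_basis_def)
  then have "vec.span ?S = UNIV"
    using vec.span_mono[of cart_basis ?S] span_cart_basis by auto
  ultimately show ?thesis
    by (simp add: is_frame_def)
qed

lemma permits_phase_retrieval_complex_frame:
  "permits_phase_retrieval (complex_frame :: (complex ^ 'n::{finite,linorder}) set)"
  unfolding permits_phase_retrieval_def
proof (intro allI impI eq_phase_multiple_if_products_eq)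
  fix \<psi> \<phi> :: "(complex, 'n) vec" and k l :: 'n
  assume eq: "\<forall>v\<in>complex_frame.
    (cmod (hermitian_inner v \<psi>))\<^sup>2 = (cmod (hermitian_inner v \<phi>))\<^sup>2"
  have "axis k 1 \<in> complex_frame" for k :: 'n
    by (auto simp: complex_frame_def)
  then have diag: "(cmod (\<psi> $ k))\<^sup>2 = (cmod (\<phi> $ k))\<^sup>2" for k
    using eq by fastforce
  have less: "\<psi> $ k * cnj (\<psi> $ l) = \<phi> $ k * cnj (\<phi> $ l)" if "k < l" for k l
  proof -
    have "axis k 1 + axis l 1 \<in> complex_frame" "axis k 1 + \<i> *s axis l 1 \<in> complex_frame"
      using that by (auto simp: complex_frame_def)
    with eq have "(cmod (cnj (\<psi> $ k) + cnj (\<psi> $ l)))\<^sup>2 = (cmod (cnj (\<phi> $ k) + cnj (\<phi> $ l)))\<^sup>2"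
      "(cmod (cnj (\<psi> $ k) + \<i> * cnj (\<psi> $ l)))\<^sup>2 = (cmod (cnj (\<phi> $ k) + \<i> * cnj (\<phi> $ l)))\<^sup>2"
      by fastforce+
    then have "cnj (\<psi> $ k) * cnj (cnj (\<psi> $ l)) = cnj (\<phi> $ k) * cnj (cnj (\<phi> $ l))"
      by (intro polarisation) (simp_all add: diag)
    from arg_cong[OF this, of cnj] show ?thesis
      by simp
  qed
  consider "k < l" | "l < k" | "k = l"
    by fastforce
  then show "\<psi> $ k * cnj (\<psi> $ l) = \<phi> $ k * cnj (\<phi> $ l)"
  proof cases
    case 2
    \<comment> \<open>The matrix of products is Hermitian.\<close>
    from arg_cong[OF less[OF this], of cnj] show ?thesis
      by (simp add: mult.commute)
  qed (use less diag[of k] in \<open>simp_all flip: complex_norm_square\<close>)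
qed

text \<open>The witnesses below are not even proportional, so every scalar is excluded, not only
  phases.\<close>

lemma not_permits_phase_retrievalI:
  assumes "\<And>v. v \<in> S \<Longrightarrow> cmod (hermitian_inner v \<psi>) = cmod (hermitian_inner v \<phi>)"
    and "\<And>c. \<phi> \<noteq> c *s \<psi>"
  shows "\<not> permits_phase_retrieval S"
  using assms unfolding permits_phase_retrieval_def by metis

lemma not_permits_phase_retrieval_remove_axis:
  fixes k :: "'n::{finite,linorder}"
  shows "\<not> permits_phase_retrieval (complex_frame - {axis k 1})"
proof -
  define f :: "complex \<Rightarrow> (complex, 'n) vec" where
    "f t = (\<chi> j. if j < k then 1 else if j = k then t else \<i>)" for t
  show ?thesis
  proof (rule not_permits_phase_retrievalI)
    fix c show "f (- 1 - \<i>) \<noteq> c *s f 0"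
    proof
      assume "f (- 1 - \<i>) = c *s f 0"
      from arg_cong[OF this, of "\<lambda>x. x $ k"] show False
        by (simp add: f_def complex_eq_iff)
    qed
  next
    fix v assume "v \<in> complex_frame - {axis k 1}"
    \<comment> \<open>Either \<open>v\<close> vanishes at \<open>k\<close> and cannot see
      \<open>t\<close>, or both moduli are 1.\<close>
    then show "cmod (hermitian_inner v (f 0)) = cmod (hermitian_inner v (f (- 1 - \<i>)))"
      by (auto simp: complex_frame_def f_def cmod_def)
  qed
qed

lemma not_permits_phase_retrieval_remove_axis_add_axis:
  fixes k l :: "'n::{finite,linorder}"
  assumes "k < l"
  shows "\<not> permits_phase_retrieval (complex_frame - {axis k 1 + axis l 1})"
proof (rule not_permits_phase_retrievalI)
  fix c show "axis k 1 - axis l 1 \<noteq> c *s (axis k 1 + axis l 1 :: (complex, 'n) vec)"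
  proof
    assume eq: "axis k 1 - axis l 1 = c *s (axis k 1 + axis l 1 :: (complex, 'n) vec)"
    \<comment> \<open>Coordinate \<open>k\<close> forces \<open>c = 1\<close>, coordinate
      \<open>l\<close> forces \<open>c = -1\<close>.\<close>
    show False
      using arg_cong[OF eq, of "\<lambda>x. x $ k"] arg_cong[OF eq, of "\<lambda>x. x $ l"] less_imp_neq[OF assms]
      by (auto simp: axis_def complex_eq_iff)
  qed
next
  fix v :: "(complex, 'n) vec"
  assume "v \<in> complex_frame - {axis k 1 + axis l 1}"
  \<comment> \<open>A relative sign shows only on vectors meeting both \<open>k\<close> and
    \<open>l\<close>. The one left yields |1 + i| = |1 - i|.\<close>
  then show "cmod (hermitian_inner v (axis k 1 + axis l 1)) =
      cmod (hermitian_inner v (axis k 1 - axis l 1))"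
    using assms by (auto simp: complex_frame_def axis_component cmod_def)
qed

lemma not_permits_phase_retrieval_remove_axis_add_i_axis:
  fixes k l :: "'n::{finite,linorder}"
  assumes "k < l"
  shows "\<not> permits_phase_retrieval (complex_frame - {axis k 1 + \<i> *s axis l 1})"
proof (rule not_permits_phase_retrievalI)
  fix c show "axis k 1 - \<i> *s axis l 1 \<noteq> c *s (axis k 1 + \<i> *s axis l 1 :: (complex, 'n) vec)"
  proof
    assume eq: "axis k 1 - \<i> *s axis l 1 = c *s (axis k 1 + \<i> *s axis l 1 :: (complex, 'n) vec)"
    show False
      using arg_cong[OF eq, of "\<lambda>x. x $ k"] arg_cong[OF eq, of "\<lambda>x. x $ l"] less_imp_neq[OF assms]
      by (auto simp: axis_def complex_eq_iff)
  qed
next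
  fix v :: "(complex, 'n) vec"
  assume "v \<in> complex_frame - {axis k 1 + \<i> *s axis l 1}"
  \<comment> \<open>Here \<open>axis k 1 + axis l 1\<close> is the one left, and it yields |1 - i| =
    |1 + i|.\<close>
  then show "cmod (hermitian_inner v (axis k 1 + \<i> *s axis l 1)) =
      cmod (hermitian_inner v (axis k 1 - \<i> *s axis l 1))"
    using assms by (auto simp: complex_frame_def axis_component cmod_def)
qed

theorem proposition3p3:
  shows "vital (complex_frame :: (complex ^ 'n::{finite,linorder}) set)"
  unfolding vital_def
proof (intro conjI ballI is_frame_complex_frame permits_phase_retrieval_complex_frame)
  fix v :: "(complex, 'n) vec"
  assume "v \<in> complex_frame"
  then consider k where "v = axis k 1"
    | k l where "k < l" "v = axis k 1 + axis l 1"
    | k l where "k < l" "v = axis k 1 + \<i> *s axis l 1"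
    unfolding complex_frame_def by blast
  then show "\<not> permits_phase_retrieval (complex_frame - {v})"
    by cases (simp_all add: not_permits_phase_retrieval_remove_axis
      not_permits_phase_retrieval_remove_axis_add_axis
      not_permits_phase_retrieval_remove_axis_add_i_axis)
qed

end
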